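(* Let $D$ be a digraph whose underlying graph $G$ contains no subdivision of the Bean Graph, and let $vw$ be an edge of $D$. Then there is either a directed cycle, a directed double ray, or a directed minimal non-empty nibble of $G$ containing $vw$.
   Context: The Bean Graph consists of a ray $S$ starting at a vertex $u$ together with a ray $R$ disjoint from $S$ such that $u$ is adjacent to every vertex of $R$. For a set $X$ of vertices of $G$ with vertex set $V$, the cut $U_X$ is the set of edges with one end in $X$ and the other in $V\setminus X$; it is a nibble if the induced subgraph $G[X]$ is rayless. A minimal non-empty nibble is a non-empty nibble containing no other non-empty nibble. A set of edges of the form $U_X$ is directed (in $D$) if either all its edges are directed from $X$ to $V\setminus X$ or all are directed from $V\setminus X$ to $X$. Directed cycles and directed double rays are cycles and double rays in which all edges are oriented consistently along the cycle/double ray. *)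

theory Defs
  imports "Graph_Theory.Digraph" "Graph_Theory.Arc_Walk"
begin

text \<open>
  Digraphs are the possibly infinite \<open>wf_digraph\<close>s, in which loops and parallel arcs are allowed.
  Accordingly, the underlying graph is a multigraph on the same edge set; the set of ends of an
  edge has one element (for a loop) or two.
\<close>

record ('v, 'e) multigraph =
  gverts :: "'v set"
  gedges :: "'e set"
  gends :: "'e \<Rightarrow> 'v set"

definition underlying :: "('v, 'e) pre_digraph \<Rightarrow> ('v, 'e) multigraph" where
  "underlying D = \<lparr>gverts = verts D, gedges = arcs D, gends = (\<lambda>e. {tail D e, head D e})\<rparr>"

definition induced :: "('v, 'e) multigraph \<Rightarrow> 'v set \<Rightarrow> ('v, 'e) multigraph" where
  "induced G X =
     \<lparr>gverts = gverts G \<inter> X, gedges = {e \<in> gedges G. gends G e \<subseteq> X}, gends = gends G\<rparr>"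

definition is_ray :: "('v, 'e) multigraph \<Rightarrow> (nat \<Rightarrow> 'v) \<Rightarrow> (nat \<Rightarrow> 'e) \<Rightarrow> bool" where
  "is_ray G r a \<longleftrightarrow> inj r \<and> range r \<subseteq> gverts G \<and>
     (\<forall>i. a i \<in> gedges G \<and> gends G (a i) = {r i, r (Suc i)})"

definition rayless :: "('v, 'e) multigraph \<Rightarrow> bool" where
  "rayless G \<longleftrightarrow> (\<nexists>r a. is_ray G r a)"

text \<open>A path is given by its list of vertices \<open>p\<close> and its list of edges \<open>q\<close>.\<close>

definition is_path :: "('v, 'e) multigraph \<Rightarrow> 'v list \<Rightarrow> 'e list \<Rightarrow> bool" where
  "is_path G p q \<longleftrightarrow> distinct p \<and> set p \<subseteq> gverts G \<and> set q \<subseteq> gedges G \<and>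
     length p = Suc (length q) \<and> (\<forall>i<length q. gends G (q ! i) = {p ! i, p ! Suc i})"

definition inner_verts :: "'v list \<Rightarrow> 'v set" where
  "inner_verts p = set (butlast (tl p))"

text \<open>
  \<open>G\<close> contains a subdivision of the loopless graph \<open>H\<close>: \<open>f\<close> gives the branch vertices, and the
  edge \<open>e\<close> of \<open>H\<close> is replaced by the path with vertices \<open>p e\<close> and edges \<open>q e\<close>. (For a loop of \<open>H\<close>
  one would have to use a cycle instead of a path.)
\<close>

definition contains_subdivision ::
    "('v, 'e) multigraph \<Rightarrow> ('w, 'd) multigraph \<Rightarrow> bool" where
  "contains_subdivision G H \<longleftrightarrow> (\<exists>f p q.
     inj_on f (gverts H) \<and> f ` gverts H \<subseteq> gverts G \<and>
     (\<forall>e\<in>gedges H. is_path G (p e) (q e) \<and> {hd (p e), last (p e)} = f ` gends H e \<and>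
        inner_verts (p e) \<inter> f ` gverts H = {}) \<and>
     (\<forall>e\<in>gedges H. \<forall>e'\<in>gedges H. e \<noteq> e' \<longrightarrow>
        inner_verts (p e) \<inter> inner_verts (p e') = {} \<and> set (q e) \<inter> set (q e') = {}))"

datatype bean_vertex = S nat | R nat

text \<open>The vertex \<open>u\<close> of the Bean Graph is \<open>S 0\<close>. Edges are identified with their sets of ends.\<close>

definition bean_graph :: "(bean_vertex, bean_vertex set) multigraph" where
  "bean_graph = \<lparr>gverts = UNIV,
     gedges = (\<Union>i. {{S i, S (Suc i)}, {R i, R (Suc i)}, {S 0, R i}}),
     gends = (\<lambda>e. e)\<rparr>"

definition edge_cut :: "('v, 'e) multigraph \<Rightarrow> 'v set \<Rightarrow> 'e set" where
  "edge_cut G X = {e \<in> gedges G. \<exists>x\<in>X. \<exists>y\<in>gverts G - X. gends G e = {x, y}}"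

definition nibble :: "('v, 'e) multigraph \<Rightarrow> 'e set \<Rightarrow> bool" where
  "nibble G F \<longleftrightarrow> (\<exists>X\<subseteq>gverts G. F = edge_cut G X \<and> rayless (induced G X))"

definition minimal_nonempty_nibble :: "('v, 'e) multigraph \<Rightarrow> 'e set \<Rightarrow> bool" where
  "minimal_nonempty_nibble G F \<longleftrightarrow> nibble G F \<and> F \<noteq> {} \<and>
     (\<forall>F'. nibble G F' \<and> F' \<noteq> {} \<and> F' \<subseteq> F \<longrightarrow> F' = F)"

definition directed_cut :: "('v, 'e) pre_digraph \<Rightarrow> 'e set \<Rightarrow> bool" where
  "directed_cut D F \<longleftrightarrow> (\<exists>X\<subseteq>verts D. F = edge_cut (underlying D) X \<and>
     ((\<forall>e\<in>F. tail D e \<in> X \<and> head D e \<in> verts D - X) \<or>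
      (\<forall>e\<in>F. tail D e \<in> verts D - X \<and> head D e \<in> X)))"

definition directed_double_ray ::
    "('v, 'e) pre_digraph \<Rightarrow> (int \<Rightarrow> 'v) \<Rightarrow> (int \<Rightarrow> 'e) \<Rightarrow> bool" where
  "directed_double_ray D r a \<longleftrightarrow> inj r \<and> range r \<subseteq> verts D \<and>
     (\<forall>i. a i \<in> arcs D \<and> tail D (a i) = r i \<and> head D (a i) = r (i + 1))"

end

theory Submission
  imports Defs
begin

text \<open>
  Let \<open>X\<close> be the set of vertices reachable from \<open>w\<close> by directed paths and \<open>Y\<close> the set of vertices
  from which \<open>v\<close> is reachable. If \<open>X\<close> and \<open>Y\<close> meet, there is a directed cycle through \<open>vw\<close>.
  Otherwise suppose first that both \<open>G[X]\<close> and \<open>G[Y]\<close> contain rays. If no directed ray starts at \<open>w\<close>,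
  a star-comb argument yields a vertex of \<open>X\<close> with an infinite fan inside \<open>X\<close> to a ray of \<open>G[X]\<close>;
  with a ray leading into \<open>G[Y]\<close> this gives a subdivision of the Bean Graph. Hence there are directed
  rays from \<open>w\<close> and, symmetrically, towards \<open>v\<close>, which form a directed double ray with \<open>vw\<close>.

  Finally suppose that, say, \<open>G[X]\<close> is rayless; its cut is directed. Let \<open>C\<close> be the component of
  \<open>G[X]\<close> containing \<open>w\<close> and \<open>K\<close> the component of \<open>G - C\<close> containing \<open>v\<close>. If \<open>K\<close> is rayless, its cut
  is a minimal nibble. Otherwise add to \<open>C\<close> all rayless components of \<open>G - C\<close>: a ray in the resulting
  set would meet \<open>C\<close> infinitely often, so star-comb and the ray in \<open>K\<close> would again give a subdivision
  of the Bean Graph; and the cut of this set is minimal, since every component on its other side that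
  is incident with it contains a ray.
\<close>

section \<open>Rays and reachability in relations\<close>

text \<open>A bare relation in place of a graph lets the same facts serve adjacency, arcs, reversed
  arcs and restrictions of these.\<close>

definition ray_of :: "('a \<Rightarrow> 'a \<Rightarrow> bool) \<Rightarrow> (nat \<Rightarrow> 'a) \<Rightarrow> bool" where
  "ray_of E r \<longleftrightarrow> inj r \<and> (\<forall>i. E (r i) (r (Suc i)))"

text \<open>Both ends must avoid \<open>F\<close>, yet the reflexive closure still relates a vertex
  of \<open>F\<close> to itself; start vertices need separate care.\<close>

definition avoiding :: "('a \<Rightarrow> 'a \<Rightarrow> bool) \<Rightarrow> 'a set \<Rightarrow> 'a \<Rightarrow> 'a \<Rightarrow> bool" where
  "avoiding E F x y \<longleftrightarrow> E x y \<and> x \<notin> F \<and> y \<notin> F"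

section \<open>Elementary operations on rays and walks\<close>

lemma ray_of_shift: "ray_of E r \<Longrightarrow> ray_of E (\<lambda>i. r (i + k))"
  unfolding ray_of_def inj_def by (metis add_Suc add_right_cancel)

lemma ray_of_mono: "ray_of E r \<Longrightarrow> (\<And>i. E (r i) (r (Suc i)) \<Longrightarrow> E' (r i) (r (Suc i))) \<Longrightarrow> ray_of E' r"
  unfolding ray_of_def by auto

lemma ray_of_reachable: "ray_of E r \<Longrightarrow> E\<^sup>*\<^sup>* (r 0) (r n)"
  unfolding ray_of_def by (induction n) (auto intro: rtranclp.rtrancl_into_rtrancl)

lemma rtranclp_invariant:
  assumes "E\<^sup>*\<^sup>* x y" "Q x" "\<And>x y. E x y \<Longrightarrow> Q x \<Longrightarrow> Q y"
  shows "Q y"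
  using assms(1,2) by (induction) (auto intro: assms(3))

lemma rtranclp_symp: "symp E \<Longrightarrow> E\<^sup>*\<^sup>* x y \<Longrightarrow> E\<^sup>*\<^sup>* y x"
  by (metis symp_rtranclp sympD)

text \<open>Going backwards along the walk, a vertex already on the ray becomes its new start, any
  other vertex is prepended. Only finitely many vertices off \<open>t\<close> are added, so a set
  missing \<open>t\<close> is met finitely often.\<close>

lemma ray_of_prepend:
  assumes "E\<^sup>*\<^sup>* x (t 0)" "ray_of E t"
  shows "\<exists>s. ray_of E s \<and> s 0 = x \<and> finite (range s - range t)"
  using assms(1)
proof (induction rule: converse_rtranclp_induct)
  case base
  then show ?case using assms(2) by (intro exI[of _ t]) auto
next
  case (step x y)
  then obtain s where s: "ray_of E s" "s 0 = y" "finite (range s - range t)" by blast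
  show ?case
  proof (cases "x \<in> range s")
    case True
    then obtain k where "x = s k" by blast
    moreover have "finite (range (\<lambda>i. s (i + k)) - range t)"
      by (rule finite_subset[OF _ s(3)]) auto
    ultimately show ?thesis
      using ray_of_shift[OF s(1), of k] by (intro exI[of _ "\<lambda>i. s (i + k)"]) auto
  next
    case False
    have r: "range (case_nat x s) = insert x (range s)"
    proof
      show "insert x (range s) \<subseteq> range (case_nat x s)"
        using rangeI[of "case_nat x s" 0] rangeI[of "case_nat x s" "Suc n" for n] by auto
    qed (auto split: nat.splits)
    have "inj (case_nat x s)"
      using s(1) False unfolding ray_of_def inj_def by (auto split: nat.splits)
    then have "ray_of E (case_nat x s)"
      using s step.hyps(1) unfolding ray_of_def by (auto split: nat.splits)
    moreover have "finite (range (case_nat x s) - range t)"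
      unfolding r using s(3) by (simp add: insert_Diff_if)
    ultimately show ?thesis by (intro exI[of _ "case_nat x s"]) auto
  qed
qed

text \<open>The path is built backwards: a vertex of \<open>U\<close> restarts it as a single
  vertex, and a repeated vertex cuts off the loop.\<close>

lemma path_to_first_hit:
  assumes "E\<^sup>*\<^sup>* x u" "u \<in> U"
  shows "\<exists>p. p \<noteq> [] \<and> hd p = x \<and> distinct p \<and> successively E p \<and> last p \<in> U
           \<and> set (butlast p) \<inter> U = {}"
  using assms(1)
proof (induction rule: converse_rtranclp_induct)
  case base
  then show ?case using assms(2) by (intro exI[of _ "[u]"]) auto
next
  case (step x y)
  then obtain p where p: "p \<noteq> []" "hd p = y" "distinct p" "successively E p" "last p \<in> U"
    "set (butlast p) \<inter> U = {}" by blast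
  consider "x \<in> U" | "x \<notin> U" "x \<in> set p" | "x \<notin> U" "x \<notin> set p" by blast
  then show ?case
  proof cases
    case 1
    then show ?thesis by (intro exI[of _ "[x]"]) auto
  next
    case 2
    then obtain ys zs where "p = ys @ x # zs" by (meson split_list)
    then show ?thesis using p
      by (intro exI[of _ "x # zs"]) (auto simp: successively_append_iff butlast_append split: if_splits)
  next
    case 3
    then show ?thesis using p step.hyps
      by (intro exI[of _ "x # p"]) (auto simp: successively_Cons)
  qed
qed

lemma successively_invariant:
  assumes "successively E p" "p \<noteq> []" "Q (hd p)" "\<And>x y. E x y \<Longrightarrow> Q x \<Longrightarrow> Q y"
  shows "\<forall>x\<in>set p. Q x"
  using assms(1-3)
proof (induction p)
  case (Cons a p)
  show ?case
  proof (cases p)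
    case p: (Cons b p')
    then have "Q b" using Cons.prems assms(4)[of a b] by simp
    then have "\<forall>x\<in>set p. Q x" using Cons.IH Cons.prems p by simp
    then show ?thesis using Cons.prems by simp
  qed (use Cons.prems in simp)
qed simp

section \<open>Walks around forbidden vertices, and the star-comb argument\<close>

lemma avoiding_leave:
  assumes "(avoiding E F)\<^sup>*\<^sup>* x u" "u \<noteq> x"
  shows "\<exists>y. E x y \<and> y \<notin> insert x F \<and> (avoiding E (insert x F))\<^sup>*\<^sup>* y u"
  using assms
proof (induction rule: rtranclp_induct)
  case (step u u')
  show ?case
  proof (cases "u = x")
    \<comment> \<open>The walk leaves \<open>x\<close> again here; the induction thus singles out
      the last departure from \<open>x\<close>, after which \<open>x\<close> is avoided.\<close>
    case True
    then show ?thesis using step by (auto simp: avoiding_def)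
  next
    case False
    then obtain y where y: "E x y" "y \<notin> insert x F" "(avoiding E (insert x F))\<^sup>*\<^sup>* y u"
      using step by blast
    moreover have "avoiding E (insert x F) u u'"
      using step False by (auto simp: avoiding_def)
    ultimately show ?thesis by (meson rtranclp.rtrancl_into_rtrancl)
  qed
qed simp

text \<open>A vertex of \<open>F'\<close> on the walk would itself be reachable from
  \<open>y\<close> and reach \<open>u\<close> while avoiding \<open>F\<close>, as the second
  assumption forbids; so the walk avoids \<open>F'\<close> as well.\<close>

lemma avoiding_union:
  assumes "(avoiding E F)\<^sup>*\<^sup>* y u"
    and "\<And>z. z \<in> F' \<Longrightarrow> (avoiding E F)\<^sup>*\<^sup>* y z \<Longrightarrow> (avoiding E F)\<^sup>*\<^sup>* z u \<Longrightarrow> False"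
  shows "(avoiding E (F \<union> F'))\<^sup>*\<^sup>* y u"
  using assms
proof (induction rule: converse_rtranclp_induct)
  case (step y y')
  have "y \<notin> F'" using step.prems[of y] step.hyps by (meson converse_rtranclp_into_rtranclp rtranclp.rtrancl_refl)
  moreover have "y' \<notin> F'" using step.prems[of y'] step.hyps by blast
  ultimately have "avoiding E (F \<union> F') y y'" using step.hyps by (auto simp: avoiding_def)
  moreover have "(avoiding E (F \<union> F'))\<^sup>*\<^sup>* y' u"
    using step by (meson converse_rtranclp_into_rtranclp)
  ultimately show ?case by (rule converse_rtranclp_into_rtranclp)
qed simp

lemma avoiding_subset: "(avoiding E F)\<^sup>*\<^sup>* x y \<Longrightarrow> F' \<subseteq> F \<Longrightarrow> (avoiding E F')\<^sup>*\<^sup>* x y"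
  by (rule mono_rtranclp[rule_format, of "avoiding E F"]) (auto simp: avoiding_def)

lemma avoiding_notin: "(avoiding E F)\<^sup>*\<^sup>* x y \<Longrightarrow> x \<notin> F \<Longrightarrow> y \<notin> F"
  by (rule rtranclp_invariant[of "avoiding E F" x y "\<lambda>z. z \<notin> F"]) (auto simp: avoiding_def)

text \<open>A directed star-comb lemma: the walk follows a vertex from which infinitely much of \<open>U\<close> can
  be reached without returning; where it cannot continue, only finitely much of \<open>U\<close> lies behind
  each successor, so finitely many vertices cannot block all of \<open>U\<close>.\<close>

lemma star_comb:
  assumes inf: "infinite {u \<in> U. E\<^sup>*\<^sup>* x0 u}"
    and noray: "\<nexists>r. ray_of E r \<and> r 0 = x0"
  shows "\<exists>c. E\<^sup>*\<^sup>* x0 c \<and>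
    (\<forall>F. finite F \<longrightarrow> c \<notin> F \<longrightarrow> (\<exists>u\<in>U - {c}. (avoiding E F)\<^sup>*\<^sup>* c u))"
proof (rule ccontr)
  assume "\<not> ?thesis"
  then have neg: "\<forall>c. E\<^sup>*\<^sup>* x0 c \<longrightarrow>
      (\<exists>F. finite F \<and> c \<notin> F \<and> (\<forall>u\<in>U - {c}. \<not> (avoiding E F)\<^sup>*\<^sup>* c u))"
    by simp
  \<comment> \<open>A state consists of the finite set \<open>F\<close> of vertices already left and
    the current vertex \<open>x\<close>, from which infinitely much of \<open>U\<close> is reachable
    off \<open>F\<close>.\<close>
  define P where "P = (\<lambda>(F, x). finite F \<and> x \<notin> F \<and> E\<^sup>*\<^sup>* x0 x \<and>
    infinite {u \<in> U. (avoiding E F)\<^sup>*\<^sup>* x u})"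
  have step: "\<exists>y. E x y \<and> P (insert x F, y)" if "P (F, x)" for F x
  proof (rule ccontr)
    assume no: "\<not> ?thesis"
    have Fx: "finite F" "x \<notin> F" "E\<^sup>*\<^sup>* x0 x" "infinite {u \<in> U. (avoiding E F)\<^sup>*\<^sup>* x u}"
      using that by (auto simp: P_def)
    let ?R = "\<lambda>y. {u \<in> U. (avoiding E (insert x F))\<^sup>*\<^sup>* y u}"
    have fin: "finite (?R y)" if "E x y" "y \<notin> insert x F" for y
    proof -
      have "E\<^sup>*\<^sup>* x0 y" using Fx(3) that(1) by (rule rtranclp.rtrancl_into_rtrancl)
      then show ?thesis using no that Fx(1) unfolding P_def by auto
    qed
    obtain F' where F': "finite F'" "x \<notin> F'"
      "\<And>u. u \<in> U - {x} \<Longrightarrow> \<not> (avoiding E F')\<^sup>*\<^sup>* x u"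
      using neg Fx(3) by metis
    \<comment> \<open>These blocking vertices reach only finitely much of \<open>U\<close>, so some
      reachable \<open>u\<close> escapes all of them.\<close>
    let ?Z = "{z \<in> F'. finite (?R z)}"
    have "finite (insert x (\<Union>z\<in>?Z. ?R z))" using F'(1) by auto
    then obtain u where u: "u \<in> U" "(avoiding E F)\<^sup>*\<^sup>* x u" "u \<noteq> x" "u \<notin> (\<Union>z\<in>?Z. ?R z)"
    proof -
      have "\<not> {u \<in> U. (avoiding E F)\<^sup>*\<^sup>* x u} \<subseteq> insert x (\<Union>z\<in>?Z. ?R z)"
        using Fx(4) \<open>finite (insert x (\<Union>z\<in>?Z. ?R z))\<close> finite_subset by blast
      then show ?thesis using that by blast
    qed
    obtain y where y: "E x y" "y \<notin> insert x F" "(avoiding E (insert x F))\<^sup>*\<^sup>* y u"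
      using avoiding_leave[OF u(2,3)] by blast
    \<comment> \<open>All of \<open>U\<close> that \<open>z\<close> reaches is reached from
      \<open>y\<close>, hence finite by \<open>fin\<close>; so \<open>z\<close> lies in
      \<open>?Z\<close>, but \<open>u\<close> was chosen outside its reach.\<close>
    have blocked: False if "z \<in> F'" "(avoiding E (insert x F))\<^sup>*\<^sup>* y z" "(avoiding E (insert x F))\<^sup>*\<^sup>* z u" for z
    proof -
      have "?R z \<subseteq> ?R y" using that(2) by auto
      then have "finite (?R z)" using fin[OF y(1,2)] by (rule finite_subset)
      then show False using that u by blast
    qed
    have "(avoiding E (insert x F \<union> F'))\<^sup>*\<^sup>* y u"
      by (rule avoiding_union[OF y(3) blocked])
    then have "(avoiding E F')\<^sup>*\<^sup>* y u" by (rule avoiding_subset) auto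
    moreover have "y \<notin> F'" using blocked[of y] y(3) by blast
    ultimately have "(avoiding E F')\<^sup>*\<^sup>* x u"
      using y(1) F'(2) by (auto simp: avoiding_def intro: converse_rtranclp_into_rtranclp)
    then show False using F'(3) u by blast
  qed
  have "\<exists>f. \<forall>n. (P (f n) \<and> (n = 0 \<longrightarrow> f n = ({}, x0))) \<and>
     (fst (f (Suc n)) = insert (snd (f n)) (fst (f n)) \<and> E (snd (f n)) (snd (f (Suc n))))"
  proof (rule dependent_nat_choice)
    have "avoiding E {} = E" by (auto simp: avoiding_def fun_eq_iff)
    then show "\<exists>x. P x \<and> ((0::nat) = 0 \<longrightarrow> x = ({}, x0))" using inf by (auto simp: P_def)
  next
    fix s :: "'a set \<times> 'a" and n :: nat
    assume "P s \<and> (n = 0 \<longrightarrow> s = ({}, x0))"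
    then show "\<exists>y. (P y \<and> (Suc n = 0 \<longrightarrow> y = ({}, x0))) \<and>
       (fst y = insert (snd s) (fst s) \<and> E (snd s) (snd y))"
      using step[of "fst s" "snd s"] by auto
  qed
  then obtain f where f: "\<And>n. P (f n)" "f 0 = ({}, x0)"
    "\<And>n. fst (f (Suc n)) = insert (snd (f n)) (fst (f n))" "\<And>n. E (snd (f n)) (snd (f (Suc n)))"
    by blast
  \<comment> \<open>Every vertex left stays in \<open>F\<close>, and the current vertex is never in
    \<open>F\<close>; so the walk does not repeat and is a ray from \<open>x0\<close>.\<close>
  have mono: "snd (f i) \<in> fst (f (i + Suc k))" for i k
    by (induction k) (auto simp: f(3))
  have "snd (f i) \<noteq> snd (f j)" if "i < j" for i j
    using mono[of i "j - Suc i"] f(1)[of j] that by (auto simp: P_def split: prod.splits)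
  then have "inj (\<lambda>n. snd (f n))" by (metis injI linorder_neqE_nat)
  then show False using noray f(2,4) unfolding ray_of_def
    by (metis snd_conv)
qed

section \<open>Subdivisions of the Bean Graph\<close>

definition adj :: "('v, 'e) multigraph \<Rightarrow> 'v \<Rightarrow> 'v \<Rightarrow> bool" where
  "adj G x y \<longleftrightarrow> (\<exists>e\<in>gedges G. gends G e = {x, y})"

definition wf_multigraph :: "('v, 'e) multigraph \<Rightarrow> bool" where
  "wf_multigraph G \<longleftrightarrow> (\<forall>e\<in>gedges G. gends G e \<subseteq> gverts G)"

lemma adj_verts: "wf_multigraph G \<Longrightarrow> adj G x y \<Longrightarrow> x \<in> gverts G \<and> y \<in> gverts G"
  unfolding wf_multigraph_def adj_def by blast

lemma adj_sym: "adj G x y \<Longrightarrow> adj G y x"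
  unfolding adj_def by (metis insert_commute)

lemma symp_adj: "symp (adj G)"
  by (meson adj_sym sympI)

section \<open>From vertex sequences to paths and subdivisions with chosen edges\<close>

lemma is_path_of_successively:
  assumes "wf_multigraph G" "distinct p" "successively (adj G) p" "length p \<ge> 2"
  shows "\<exists>q. is_path G p q"
proof -
  have a: "adj G (p ! i) (p ! Suc i)" if "Suc i < length p" for i
    using successively_nth[OF assms(3)] that by blast
  then have "\<forall>i. \<exists>e. Suc i < length p \<longrightarrow> e \<in> gedges G \<and> gends G e = {p ! i, p ! Suc i}"
    unfolding adj_def by blast
  then obtain g where g: "\<And>i. Suc i < length p \<Longrightarrow> g i \<in> gedges G \<and> gends G (g i) = {p ! i, p ! Suc i}"
    by metis
  have "x \<in> gverts G" if "x \<in> set p" for x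
  proof -
    obtain i where i: "x = p ! i" "i < length p" using \<open>x \<in> set p\<close> by (metis in_set_conv_nth)
    show ?thesis
    proof (cases "Suc i < length p")
      case True
      then show ?thesis using a adj_verts[OF assms(1)] i by blast
    next
      case False
      then have "Suc (i - 1) < length p" "Suc (i - 1) = i" using i assms(4) by auto
      then show ?thesis using a[of "i - 1"] adj_verts[OF assms(1)] i by metis
    qed
  qed
  then have "is_path G p (map g [0..<length p - 1])"
    unfolding is_path_def using assms(2,4) g by auto
  then show ?thesis by blast
qed

lemma path_verts_cases:
  assumes "length p \<ge> 2" "x \<in> set p"
  shows "x \<in> inner_verts p \<or> x = hd p \<or> x = last p"
  using assms unfolding inner_verts_def
  by (cases p; cases "tl p" rule: rev_cases) auto

text \<open>Edge-disjointness follows from the vertices. A shared edge has two distinct ends on both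
  paths; a vertex common to both paths is a branch vertex at which both end, so the two edges of
  \<open>H\<close> would have the same ends, and \<open>H\<close> has no parallel edges.\<close>

lemma contains_subdivision_of_vertex_paths:
  assumes G: "wf_multigraph G"
    and f: "inj_on f (gverts H)" "f ` gverts H \<subseteq> gverts G"
    and H: "\<And>e. e \<in> gedges H \<Longrightarrow> gends H e \<subseteq> gverts H" "inj_on (gends H) (gedges H)"
    and p: "\<And>e. e \<in> gedges H \<Longrightarrow> distinct (p e) \<and> successively (adj G) (p e) \<and> length (p e) \<ge> 2
        \<and> {hd (p e), last (p e)} = f ` gends H e \<and> inner_verts (p e) \<inter> f ` gverts H = {}"
    and disj: "\<And>e e'. e \<in> gedges H \<Longrightarrow> e' \<in> gedges H \<Longrightarrow> e \<noteq> e' \<Longrightarrow>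
        inner_verts (p e) \<inter> inner_verts (p e') = {}"
  shows "contains_subdivision G H"
proof -
  have "\<forall>e\<in>gedges H. \<exists>q. is_path G (p e) q"
    using p is_path_of_successively[OF G] by blast
  then obtain q where q: "\<And>e. e \<in> gedges H \<Longrightarrow> is_path G (p e) (q e)" by metis
  have ends: "\<exists>x y. gends G a = {x, y} \<and> x \<noteq> y \<and> x \<in> set (p e) \<and> y \<in> set (p e)"
    if "e \<in> gedges H" "a \<in> set (q e)" for a e
  proof -
    obtain i where i: "i < length (q e)" "a = q e ! i" using \<open>a \<in> set (q e)\<close> by (metis in_set_conv_nth)
    have "is_path G (p e) (q e)" using q that by blast
    then have "gends G a = {p e ! i, p e ! Suc i}" "p e ! i \<noteq> p e ! Suc i"
      "p e ! i \<in> set (p e)" "p e ! Suc i \<in> set (p e)"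
      using i unfolding is_path_def by (auto simp: nth_eq_iff_index_eq)
    then show ?thesis by blast
  qed
  have common: "x \<in> f ` gends H e \<and> x \<in> f ` gends H e'"
    if e: "e \<in> gedges H" "e' \<in> gedges H" "e \<noteq> e'" and x: "x \<in> set (p e)" "x \<in> set (p e')" for e e' x
  proof -
    have 1: "x \<in> inner_verts (p e) \<or> x \<in> f ` gends H e"
      using path_verts_cases[of "p e" x] p[OF e(1)] x(1) by (metis insertCI)
    have 2: "x \<in> inner_verts (p e') \<or> x \<in> f ` gends H e'"
      using path_verts_cases[of "p e'" x] p[OF e(2)] x(2) by (metis insertCI)
    have 3: "f ` gends H e \<subseteq> f ` gverts H" "f ` gends H e' \<subseteq> f ` gverts H"
      using H(1) e by blast+
    have 4: "inner_verts (p e) \<inter> f ` gverts H = {}" "inner_verts (p e') \<inter> f ` gverts H = {}"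
      using p[OF e(1)] p[OF e(2)] by simp_all
    show ?thesis using 1 2 subsetD[OF 3(1), of x] subsetD[OF 3(2), of x] 4 disj[OF e]
      unfolding disjoint_iff by metis
  qed
  have "set (q e) \<inter> set (q e') = {}" if e: "e \<in> gedges H" "e' \<in> gedges H" "e \<noteq> e'" for e e'
  proof (rule ccontr)
    assume "\<not> ?thesis"
    then obtain a where a: "a \<in> set (q e)" "a \<in> set (q e')" by blast
    obtain x y where xy: "gends G a = {x, y}" "x \<noteq> y" "x \<in> set (p e)" "y \<in> set (p e)"
      using ends[OF e(1) a(1)] by blast
    have "x \<in> set (p e')" "y \<in> set (p e')" using ends[OF e(2) a(2)] xy(1,2) by (auto simp: doubleton_eq_iff)
    then have "x \<in> f ` gends H e" "y \<in> f ` gends H e" "x \<in> f ` gends H e'" "y \<in> f ` gends H e'"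
      using common[OF e] xy by simp_all
    moreover have "\<exists>b c. f ` gends H e = {b, c}" "\<exists>b c. f ` gends H e' = {b, c}"
      using p[OF e(1)] p[OF e(2)] by metis+
    moreover have "T = {x, y}" if "x \<in> T" "y \<in> T" "\<exists>b c. T = {b, c}" for T
      using that xy(2) by auto
    ultimately have "f ` gends H e = {x, y}" "f ` gends H e' = {x, y}" by blast+
    then have "gends H e = gends H e'"
      using inj_on_image_eq_iff[OF f(1) H(1) H(1)] e by metis
    then show False using H(2) e by (metis inj_onD)
  qed
  then show ?thesis
    unfolding contains_subdivision_def using f p q disj
    by (intro exI[of _ f] exI[of _ p] exI[of _ q]) simp
qed

section \<open>Recognising a subdivided Bean Graph\<close>

lemma inner_verts_map_upt:
  "a < b \<Longrightarrow> inner_verts (map r [a..<Suc b]) = r ` {a<..<b}"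
proof -
  assume "a < b"
  then have "tl (map r [a..<Suc b]) = map r [Suc a..<b] @ [r b]"
    by (simp add: upt_conv_Cons)
  then have "butlast (tl (map r [a..<Suc b])) = map r [Suc a..<b]"
    by simp
  then show ?thesis
    unfolding inner_verts_def by (auto simp: image_iff)
qed

lemma inner_verts_subset: "distinct p \<Longrightarrow> inner_verts p \<subseteq> set (butlast p) - {hd p}"
  unfolding inner_verts_def by (cases p) (auto dest: in_set_butlastD)

text \<open>The ray \<open>s\<close> plays the part of \<open>S\<close>; the vertices
  \<open>r (n i)\<close> become those of \<open>R\<close>, joined by segments of \<open>r\<close>,
  and the fan \<open>P\<close> replaces the edges from \<open>u\<close> to \<open>R\<close>.\<close>

lemma contains_bean_of_rays_and_fan:
  assumes G: "wf_multigraph G"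
    and s: "ray_of (adj G) s" and r: "ray_of (adj G) r" and sr: "range s \<inter> range r = {}"
    and n: "strict_mono (n :: nat \<Rightarrow> nat)"
    and P: "\<And>i. distinct (P i) \<and> successively (adj G) (P i) \<and> length (P i) \<ge> 2
        \<and> hd (P i) = s 0 \<and> last (P i) = r (n i) \<and> inner_verts (P i) \<inter> (range s \<union> range r) = {}"
    and disj: "\<And>i j. i \<noteq> j \<Longrightarrow> inner_verts (P i) \<inter> inner_verts (P j) = {}"
  shows "contains_subdivision G bean_graph"
proof -
  define f where "f v = (case v of S i \<Rightarrow> s i | R i \<Rightarrow> r (n i))" for v
  \<comment> \<open>Edges of the Bean Graph are sets of ends, so kind and index are read off the
    set: the minimum recovers \<open>i\<close> from \<open>{i, Suc i}\<close>, and from the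
    singleton in the case of a spoke.\<close>
  define p where "p e = (if \<forall>j. R j \<notin> e then let i = Min {i. S i \<in> e} in [s i, s (Suc i)]
     else let j = Min {j. R j \<in> e} in if \<forall>i. S i \<notin> e then map r [n j..<Suc (n (Suc j))] else P j)"
    for e
  have pS: "p {S i, S (Suc i)} = [s i, s (Suc i)]" for i
  proof -
    have "{j. S j \<in> {S i, S (Suc i)}} = {i, Suc i}" by auto
    then have "Min {j. S j \<in> {S i, S (Suc i)}} = i" by simp
    then show ?thesis unfolding p_def Let_def by simp
  qed
  have pR: "p {R i, R (Suc i)} = map r [n i..<Suc (n (Suc i))]" for i
  proof -
    have "{j. R j \<in> {R i, R (Suc i)}} = {i, Suc i}" by auto
    then have "Min {j. R j \<in> {R i, R (Suc i)}} = i" by simp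
    moreover have "\<not> (\<forall>j. R j \<notin> {R i, R (Suc i)})" "\<forall>j. S j \<notin> {R i, R (Suc i)}" by auto
    ultimately show ?thesis unfolding p_def Let_def by presburger
  qed
  have pP: "p {S 0, R i} = P i" for i
  proof -
    have "{j. R j \<in> {S 0, R i}} = {i}" by auto
    then have "Min {j. R j \<in> {S 0, R i}} = i" by simp
    moreover have "\<not> (\<forall>j. R j \<notin> {S 0, R i})" "\<not> (\<forall>j. S j \<notin> {S 0, R i})" by auto
    ultimately show ?thesis unfolding p_def Let_def by presburger
  qed
  have inj: "r i = r j \<longleftrightarrow> i = j" "s i = s j \<longleftrightarrow> i = j" "n i = n j \<longleftrightarrow> i = j" "s i \<noteq> r j" "r j \<noteq> s i" for i j
    using r s sr strict_mono_eq[OF n] unfolding ray_of_def inj_def by auto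
  have nS: "n i < n (Suc i)" for i using n by (simp add: strict_mono_Suc_iff)
  have iS: "inner_verts (p {S i, S (Suc i)}) = {}" for i
    unfolding pS inner_verts_def by simp
  have iR: "inner_verts (p {R i, R (Suc i)}) = r ` {n i<..<n (Suc i)}" for i
    unfolding pR by (rule inner_verts_map_upt[OF nS])
  have gap: "\<not> (n i < n j \<and> n j < n (Suc i))" for i j
    using strict_mono_less[OF n] by simp
  have edges: "gedges bean_graph = (\<Union>i. {{S i, S (Suc i)}, {R i, R (Suc i)}, {S 0, R i}})"
    and ends: "gends bean_graph e = e" and verts: "gverts bean_graph = UNIV" for e
    by (simp_all add: bean_graph_def)
  have rangef: "range f \<subseteq> range s \<union> range r" unfolding f_def by (auto split: bean_vertex.splits)
  show ?thesis
  proof (rule contains_subdivision_of_vertex_paths[OF G, where f = f and p = p])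
    show "inj_on f (gverts bean_graph)"
      unfolding inj_on_def f_def by (auto simp: inj split: bean_vertex.splits)
    have "range s \<subseteq> gverts G" "range r \<subseteq> gverts G"
      using s r adj_verts[OF G] unfolding ray_of_def by blast+
    then show "f ` gverts bean_graph \<subseteq> gverts G" using rangef unfolding verts by blast
    show "gends bean_graph e \<subseteq> gverts bean_graph" for e by (simp add: verts)
    show "inj_on (gends bean_graph) (gedges bean_graph)" by (simp add: ends inj_on_def)
  next
    fix e assume "e \<in> gedges bean_graph"
    then consider i where "e = {S i, S (Suc i)}" | i where "e = {R i, R (Suc i)}" | i where "e = {S 0, R i}"
      unfolding edges by blast
    then show "distinct (p e) \<and> successively (adj G) (p e) \<and> length (p e) \<ge> 2
        \<and> {hd (p e), last (p e)} = f ` gends bean_graph e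
        \<and> inner_verts (p e) \<inter> f ` gverts bean_graph = {}"
    proof cases
      case (1 i)
      then show ?thesis using s iS[of i] by (simp add: pS ends f_def ray_of_def inj)
    next
      case (2 i)
      have "inner_verts (p e) \<inter> range f = {}"
        unfolding 2 iR f_def using gap by (auto simp: inj split: bean_vertex.splits)
      moreover have "successively (adj G) (p e)"
        unfolding 2 pR successively_map successively_conv_nth using r by (auto simp: ray_of_def simp del: upt_Suc)
      moreover have "distinct (p e)"
        unfolding 2 pR using r by (auto simp: distinct_map ray_of_def intro: inj_on_subset)
      moreover have "hd (p e) = r (n i)" "last (p e) = r (n (Suc i))" "length (p e) \<ge> 2"
        unfolding 2 pR using nS[of i] by (auto simp: hd_map last_map hd_append)
      ultimately show ?thesis unfolding ends verts 2 by (simp add: f_def)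
    next
      case (3 i)
      have "inner_verts (P i) \<inter> range f = {}" using P[of i] rangef by blast
      then show ?thesis using P[of i] by (simp add: 3 pP ends verts f_def)
    qed
  next
    have RR: "r ` {n i<..<n (Suc i)} \<inter> r ` {n j<..<n (Suc j)} = {}" if "i \<noteq> j" for i j
    proof -
      have "n (Suc i) \<le> n j \<or> n (Suc j) \<le> n i"
        using that strict_mono_less_eq[OF n] by (metis Suc_leI linorder_neqE_nat)
      then show ?thesis by (auto simp: inj)
    qed
    have RP: "r ` X \<inter> inner_verts (P i) = {}" "inner_verts (P i) \<inter> r ` X = {}" for X i
      using P[of i] by blast+
    have kinds: "inner_verts (p e) = {}
        \<or> (\<exists>i. e = {R i, R (Suc i)} \<and> inner_verts (p e) = r ` {n i<..<n (Suc i)})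
        \<or> (\<exists>i. e = {S 0, R i} \<and> inner_verts (p e) = inner_verts (P i))"
      if in_edges: "e \<in> gedges bean_graph" for e
    proof -
      consider i where "e = {S i, S (Suc i)}" | i where "e = {R i, R (Suc i)}" | i where "e = {S 0, R i}"
        using in_edges unfolding edges by blast
      then show ?thesis by cases (use iS iR pP in blast, use iR in blast, use pP in auto)
    qed
    fix e e' assume e: "e \<in> gedges bean_graph" "e' \<in> gedges bean_graph" "e \<noteq> e'"
    show "inner_verts (p e) \<inter> inner_verts (p e') = {}"
      using kinds[OF e(1)] kinds[OF e(2)]
    proof (elim disjE exE conjE)
      fix i j
      assume "e = {R i, R (Suc i)}" "inner_verts (p e) = r ` {n i<..<n (Suc i)}"
        "e' = {R j, R (Suc j)}" "inner_verts (p e') = r ` {n j<..<n (Suc j)}"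
      then show ?thesis using RR[of i j] e(3) by metis
    next
      fix i j
      assume "e = {S 0, R i}" "inner_verts (p e) = inner_verts (P i)"
        "e' = {S 0, R j}" "inner_verts (p e') = inner_verts (P j)"
      then show ?thesis using disj[of i j] e(3) by metis
    qed (simp_all add: RP)
  qed
qed

text \<open>Otherwise star-comb yields a centre \<open>c\<close> that no finite set separates from
  \<open>r\<close> within \<open>H\<close>. A ray from \<open>c\<close> with only finitely many
  vertices off \<open>t\<close> meets \<open>A\<close> finitely often, so spokes in \<open>A\<close>
  from \<open>c\<close> to a tail of \<open>r\<close> can be chosen one by one, avoiding that ray
  and each other except at \<open>c\<close>. This is a subdivided Bean Graph.\<close>

lemma finite_reachable_on_ray:
  assumes G: "wf_multigraph G" and nobean: "\<not> contains_subdivision G bean_graph"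
    and r: "ray_of (adj G) r" "range r \<subseteq> A"
    and t: "ray_of (adj G) t" "range t \<inter> A = {}"
    and H: "\<And>x y. H x y \<Longrightarrow> adj G x y" "\<And>x. H\<^sup>*\<^sup>* x0 x \<Longrightarrow> x \<in> A"
    and noray: "\<nexists>\<rho>. ray_of H \<rho> \<and> \<rho> 0 = x0"
    and conn: "(adj G)\<^sup>*\<^sup>* x0 (t 0)"
  shows "finite {u \<in> range r. H\<^sup>*\<^sup>* x0 u}"
proof (rule ccontr)
  assume "infinite {u \<in> range r. H\<^sup>*\<^sup>* x0 u}"
  from star_comb[OF this noray] obtain c where c: "H\<^sup>*\<^sup>* x0 c"
    and fan: "\<And>F. finite F \<Longrightarrow> c \<notin> F \<Longrightarrow> \<exists>u\<in>range r - {c}. (avoiding H F)\<^sup>*\<^sup>* c u"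
    by metis
  have "(adj G)\<^sup>*\<^sup>* x0 c" using c H(1) by (rule mono_rtranclp[rule_format, rotated])
  then have "(adj G)\<^sup>*\<^sup>* c (t 0)"
    using conn rtranclp_symp[OF symp_adj] by (meson rtranclp_trans)
  then obtain s where s: "ray_of (adj G) s" "s 0 = c" "finite (range s - range t)"
    using ray_of_prepend t(1) by metis
  have finA: "finite (A \<inter> range s)"
    by (rule finite_subset[OF _ s(3)]) (use t(2) in blast)
  then have "finite (r -` (A \<inter> range s))"
    using r(1) by (intro finite_vimageI) (auto simp: ray_of_def)
  then obtain N where N: "\<forall>i \<in> r -` (A \<inter> range s). i < N"
    unfolding finite_nat_set_iff_bounded by metis
  define r' where "r' i = r (i + N)" for i
  have r': "ray_of (adj G) r'" unfolding r'_def using r(1) by (rule ray_of_shift)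
  have r'A: "range r' \<subseteq> A" using r(2) by (auto simp: r'_def)
  have sr': "range s \<inter> range r' = {}"
  proof (rule ccontr)
    assume "range s \<inter> range r' \<noteq> {}"
    then obtain i where "r' i \<in> range s" by (metis disjoint_iff rangeE)
    then have "r' i \<in> A \<inter> range s" using r'A by auto
    then have "i + N \<in> r -` (A \<inter> range s)" unfolding r'_def by simp
    then show False using N by (meson not_add_less2)
  qed
  have cr': "c \<notin> range r'" using sr' s(2) by (metis disjoint_iff rangeI)
  \<comment> \<open>Spokes: paths from \<open>c\<close> that meet the shortened ray at most in their
    last vertex and the ray \<open>s\<close> only in \<open>c\<close>.\<close>
  define good where "good p \<longleftrightarrow> distinct p \<and> successively (adj G) p \<and> length p \<ge> 2 \<and> hd p = c
      \<and> set (butlast p) \<inter> range r' = {} \<and> set p \<inter> (range s - {c}) = {}" for p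
  have path: "\<exists>p. good p \<and> last p \<in> range r' \<and> set p \<inter> K = {}"
    if K: "finite K" "c \<notin> K" "A \<inter> range s - {c} \<subseteq> K" for K
  proof -
    \<comment> \<open>The discarded part of \<open>r\<close> is blocked too, so that the vertex of
      \<open>r\<close> reached lies on \<open>r'\<close>; \<open>c\<close> may itself be in that
      part and is exempted.\<close>
    define F where "F = K \<union> (r ` {..<N} - {c})"
    have F: "finite F" "c \<notin> F" using K by (auto simp: F_def)
    obtain u where u: "u \<in> range r" "u \<noteq> c" "(avoiding H F)\<^sup>*\<^sup>* c u" using fan[OF F] by blast
    have "u \<notin> F" using avoiding_notin[OF u(3)] F(2) by blast
    obtain k where k: "u = r k" using u(1) by auto
    then have "\<not> k < N" using u(2) \<open>u \<notin> F\<close> unfolding F_def by auto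
    then have "u = r' (k - N)" unfolding r'_def k by simp
    then have "u \<in> range r'" by simp
    from path_to_first_hit[OF u(3) this] obtain p where p: "p \<noteq> []" "hd p = c" "distinct p"
      "successively (avoiding H F) p" "last p \<in> range r'" "set (butlast p) \<inter> range r' = {}"
      by blast
    have "\<forall>x\<in>set p. x \<notin> F \<and> H\<^sup>*\<^sup>* x0 x"
      by (rule successively_invariant[OF p(4,1)])
        (use F(2) p(2) c in \<open>auto simp: avoiding_def intro: rtranclp.rtrancl_into_rtrancl\<close>)
    then have pF: "set p \<inter> F = {}" "set p \<subseteq> A" using H(2) by blast+
    have "hd p \<noteq> last p" using p(2,5) cr' by metis
    then have "length p \<ge> 2" using p(1) by (cases p; cases "tl p") auto
    moreover have "successively (adj G) p"
      by (rule successively_mono[OF p(4)]) (auto simp: avoiding_def H(1))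
    moreover have "set p \<inter> (range s - {c}) = {}" using pF K(3) unfolding F_def by blast
    ultimately have "good p" using p unfolding good_def by blast
    then show ?thesis using p(5) pF(1) unfolding F_def by blast
  qed
  \<comment> \<open>\<open>K\<close> collects all that later spokes must avoid. Including
    \<open>r'\<close> up to the end of the current spoke makes every later spoke end further along
    \<open>r'\<close>.\<close>
  define Q where "Q = (\<lambda>(p, n::nat, K). finite K \<and> c \<notin> K \<and> A \<inter> range s - {c} \<subseteq> K \<and> set p - {c} \<subseteq> K
      \<and> r' ` {..n} \<subseteq> K \<and> good p \<and> last p = r' n)"
  have next_path: "\<exists>p n K'. Q (p, n, K') \<and> set p \<inter> K = {} \<and> K \<subseteq> K'"
    if K: "finite K" "c \<notin> K" "A \<inter> range s - {c} \<subseteq> K" for K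
  proof -
    obtain p n where p: "good p" "last p = r' n" "set p \<inter> K = {}" using path[OF K] by (metis rangeE)
    have "c \<notin> r' ` {..n}" using cr' by auto
    then have "Q (p, n, K \<union> (set p - {c}) \<union> r' ` {..n})" using p K unfolding Q_def by auto
    then show ?thesis using p(3) by blast
  qed
  define P where "P x = fst x" for x :: "'a list \<times> nat \<times> 'a set"
  define n where "n x = fst (snd x)" for x :: "'a list \<times> nat \<times> 'a set"
  define K where "K x = snd (snd x)" for x :: "'a list \<times> nat \<times> 'a set"
  note sel = P_def n_def K_def
  have "\<exists>h. \<forall>i. Q (h i) \<and> (set (P (h (Suc i))) \<inter> K (h i) = {} \<and> K (h i) \<subseteq> K (h (Suc i)))"
  proof (rule dependent_nat_choice)
    show "\<exists>x. Q x" using next_path[of "A \<inter> range s - {c}"] finA by blast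
  next
    fix x i assume "Q x"
    then have "finite (K x)" "c \<notin> K x" "A \<inter> range s - {c} \<subseteq> K x"
      unfolding Q_def sel by auto
    from next_path[OF this] obtain p m K' where "Q (p, m, K')" "set p \<inter> K x = {}" "K x \<subseteq> K'"
      by blast
    then show "\<exists>y. Q y \<and> set (P y) \<inter> K x = {} \<and> K x \<subseteq> K y"
      by (intro exI[of _ "(p, m, K')"]) (simp add: sel)
  qed
  then obtain h where h: "\<And>i. Q (h i)" "\<And>i. set (P (h (Suc i))) \<inter> K (h i) = {}"
    "\<And>i. K (h i) \<subseteq> K (h (Suc i))" by blast
  have hQ: "set (P (h i)) - {c} \<subseteq> K (h i)" "r' ` {..n (h i)} \<subseteq> K (h i)" "good (P (h i))"
    "last (P (h i)) = r' (n (h i))" for i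
    using h(1)[of i] unfolding Q_def sel by (auto split: prod.splits)
  have mono: "K (h i) \<subseteq> K (h (i + k))" for i k
    using h(3) by (induction k) auto
  have new: "set (P (h j)) \<inter> K (h i) = {}" if "i < j" for i j
    using mono[of i "j - Suc i"] h(2)[of "j - 1"] that by auto
  have ne: "P (h i) \<noteq> []" for i using hQ(3)[of i] unfolding good_def by auto
  have "n (h i) < n (h (Suc i))" for i
  proof (rule ccontr)
    assume "\<not> ?thesis"
    then have "r' (n (h (Suc i))) \<in> K (h i)" using hQ(2)[of i] by auto
    moreover have "r' (n (h (Suc i))) \<in> set (P (h (Suc i)))"
      using hQ(4)[of "Suc i"] ne last_in_set by metis
    ultimately show False using h(2)[of i] by blast
  qed
  then have mono_n: "strict_mono (\<lambda>i. n (h i))" by (simp add: strict_mono_Suc_iff)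
  have inner: "inner_verts (P (h i)) \<subseteq> set (butlast (P (h i))) - {c}" for i
    using inner_verts_subset[of "P (h i)"] hQ(3)[of i] unfolding good_def by simp
  have inner': "inner_verts (P (h i)) \<subseteq> set (P (h i)) - {c}" for i
    using inner[of i] in_set_butlastD by fast
  have dj: "inner_verts (P (h i)) \<inter> inner_verts (P (h j)) = {}" if "i < j" for i j
    using new[OF that] inner'[of i] inner'[of j] hQ(1)[of i] by blast
  have "contains_subdivision G bean_graph"
  proof (rule contains_bean_of_rays_and_fan[OF G s(1) r' sr' mono_n])
    fix i
    have "inner_verts (P (h i)) \<inter> (range s \<union> range r') = {}"
    proof -
      have "I \<inter> (M \<union> L) = {}"
        if "I \<subseteq> B - {c}" "I \<subseteq> T - {c}" "B \<inter> L = {}" "T \<inter> (M - {c}) = {}" for I B T M L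
        using that by blast
      from this[OF inner inner'] show ?thesis using hQ(3)[of i] unfolding good_def by simp
    qed
    then show "distinct (P (h i)) \<and> successively (adj G) (P (h i)) \<and> length (P (h i)) \<ge> 2
      \<and> hd (P (h i)) = s 0 \<and> last (P (h i)) = r' (n (h i))
      \<and> inner_verts (P (h i)) \<inter> (range s \<union> range r') = {}"
      using hQ(3,4)[of i] s(2) unfolding good_def by simp
  next
    fix i j :: nat assume "i \<noteq> j"
    then show "inner_verts (P (h i)) \<inter> inner_verts (P (h j)) = {}"
      using dj[of i j] dj[of j i] by (cases "i < j") auto
  qed
  then show False using nobean by blast
qed

section \<open>Minimal nibbles inside cuts\<close>

lemma rayless_induced_iff:
  assumes "wf_multigraph G"
  shows "rayless (induced G X) \<longleftrightarrow> (\<nexists>r. ray_of (adj G) r \<and> range r \<subseteq> X)"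
proof
  assume rl: "rayless (induced G X)"
  show "\<nexists>r. ray_of (adj G) r \<and> range r \<subseteq> X"
  proof
    assume "\<exists>r. ray_of (adj G) r \<and> range r \<subseteq> X"
    then obtain r where r: "inj r" "\<And>i. adj G (r i) (r (Suc i))" "range r \<subseteq> X"
      by (auto simp: ray_of_def)
    obtain a where a: "\<And>i. a i \<in> gedges G \<and> gends G (a i) = {r i, r (Suc i)}"
      using r(2) unfolding adj_def by metis
    have "range r \<subseteq> gverts G" using r(2) adj_verts[OF assms] by blast
    then have "is_ray (induced G X) r a" using r a unfolding is_ray_def induced_def by auto
    then show False using rl unfolding rayless_def by blast
  qed
next
  assume no: "\<nexists>r. ray_of (adj G) r \<and> range r \<subseteq> X"
  show "rayless (induced G X)"
    unfolding rayless_def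
  proof
    assume "\<exists>r a. is_ray (induced G X) r a"
    then obtain r a where "is_ray (induced G X) r a" by blast
    then have r: "inj r" "range r \<subseteq> X" "\<And>i. a i \<in> gedges G \<and> gends G (a i) = {r i, r (Suc i)}"
      unfolding is_ray_def induced_def by auto
    then have "ray_of (adj G) r" unfolding ray_of_def adj_def by metis
    then show False using no r(2) by simp
  qed
qed

lemma edge_cut_separates:
  assumes "edge_cut G Y \<subseteq> F" "wf_multigraph G"
    and "\<And>e. e \<in> F \<Longrightarrow> gends G e \<noteq> {x, y}" "adj G x y"
  shows "x \<in> Y \<longleftrightarrow> y \<in> Y"
proof -
  obtain e where e: "e \<in> gedges G" "gends G e = {x, y}" using assms(4) unfolding adj_def by blast
  then have "e \<notin> edge_cut G Y" using assms(1,3) by blast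
  moreover have "x \<in> gverts G" "y \<in> gverts G" using adj_verts[OF assms(2,4)] by blast+
  ultimately show ?thesis using e unfolding edge_cut_def by (auto simp: doubleton_eq_iff)
qed

text \<open>The set \<open>Z\<close> is the side of the cut \<open>F\<close> that contains the \<open>X\<close>-ends of its edges; it need not
  be the rayless side.\<close>

lemma minimal_nibble_in_cut:
  assumes G: "wf_multigraph G" and nobean: "\<not> contains_subdivision G bean_graph"
    and X: "\<nexists>r. ray_of (adj G) r \<and> range r \<subseteq> X"
    and e: "e \<in> edge_cut G X"
  shows "\<exists>F Z. minimal_nonempty_nibble G F \<and> e \<in> F \<and> Z \<subseteq> gverts G \<and> F = edge_cut G Z \<and>
    (\<forall>f\<in>F. \<exists>x\<in>X \<inter> Z. \<exists>y\<in>gverts G - X - Z. gends G f = {x, y})"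
proof -
  obtain x0 y0 where x0: "x0 \<in> X" and y0: "y0 \<in> gverts G - X" and e0: "e \<in> gedges G" "gends G e = {x0, y0}"
    using e unfolding edge_cut_def by blast
  define V where "V = gverts G"
  \<comment> \<open>Adjacency within \<open>X\<close>; thus \<open>C\<close> is the component of
    \<open>x0\<close> in \<open>G[X]\<close>.\<close>
  define inX where "inX = avoiding (adj G) (- X)"
  define C where "C = {c. inX\<^sup>*\<^sup>* x0 c}"
  define off where "off = avoiding (adj G) C"
  \<comment> \<open>For a vertex \<open>z\<close> of \<open>G\<close> outside \<open>C\<close> this
    is the component of \<open>G - C\<close> containing \<open>z\<close>.\<close>
  define comp where "comp z = {k. off\<^sup>*\<^sup>* z k}" for z
  define K where "K = comp y0"
  have x0y0: "adj G x0 y0" using e0 unfolding adj_def by blast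
  have V: "x0 \<in> V" "y0 \<in> V" using adj_verts[OF G x0y0] by (auto simp: V_def)
  have CX: "C \<subseteq> X" unfolding C_def inX_def using avoiding_notin[of "adj G" "- X" x0] x0 by blast
  have x0C: "x0 \<in> C" by (simp add: C_def)
  have y0C: "y0 \<notin> C" using CX y0 by blast
  have C_step: "y \<in> C" if "x \<in> C" "adj G x y" "y \<in> X" for x y
  proof -
    have "inX x y" using that CX by (auto simp: inX_def avoiding_def)
    then show ?thesis using \<open>x \<in> C\<close> unfolding C_def by (auto intro: rtranclp.rtrancl_into_rtrancl)
  qed
  have symoff: "symp off" unfolding off_def avoiding_def by (rule sympI) (auto intro: adj_sym)
  have comp_eq: "comp z = comp z'" if "z' \<in> comp z" for z z'
    using that rtranclp_symp[OF symoff] unfolding comp_def by (auto intro: rtranclp_trans)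
  have comp_refl: "z \<in> comp z" for z by (simp add: comp_def)
  have comp_off: "z' \<notin> C" if "z' \<in> comp z" "z \<notin> C" for z z'
    using that avoiding_notin[of "adj G" C] unfolding comp_def off_def by blast
  have comp_step: "y \<in> comp x" if "adj G x y" "x \<notin> C" "y \<notin> C" for x y
    using that unfolding comp_def off_def by (auto simp: avoiding_def)
  have comp_V: "comp z \<subseteq> V" if "z \<in> V" for z
  proof
    fix k assume "k \<in> comp z"
    then have "off\<^sup>*\<^sup>* z k" by (simp add: comp_def)
    then show "k \<in> V"
      using that by (rule rtranclp_invariant) (use adj_verts[OF G] in \<open>auto simp: off_def avoiding_def V_def\<close>)
  qed
  have C_V: "C \<subseteq> V"
  proof
    fix k assume "k \<in> C"
    then have "inX\<^sup>*\<^sup>* x0 k" by (simp add: C_def)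
    then show "k \<in> V"
      using V(1) by (rule rtranclp_invariant) (use adj_verts[OF G] in \<open>auto simp: inX_def avoiding_def V_def\<close>)
  qed
  \<comment> \<open>The edges of \<open>F\<close> all join \<open>C\<close> to its complement, so a
    cut inside \<open>F\<close> splits neither \<open>C\<close> nor a component of
    \<open>G - C\<close>.\<close>
  have same_side: "(x \<in> Y \<longleftrightarrow> x' \<in> Y)"
    if cut: "edge_cut G Y \<subseteq> F" and F: "\<And>f. f \<in> F \<Longrightarrow> \<exists>a\<in>C. \<exists>b\<in>-C. gends G f = {a, b}"
      and x: "(x \<in> C \<and> x' \<in> C) \<or> (x' \<in> comp x \<and> x \<notin> C)" for Y F x x'
  proof -
    have one: "a \<in> Y \<longleftrightarrow> b \<in> Y" if "adj G a b" "a \<in> C \<longleftrightarrow> b \<in> C" for a b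
    proof (rule edge_cut_separates[OF cut G _ that(1)])
      fix f assume "f \<in> F"
      then obtain c d where "c \<in> C" "d \<notin> C" "gends G f = {c, d}" using F by blast
      then show "gends G f \<noteq> {a, b}" using that(2) by (auto simp: doubleton_eq_iff)
    qed
    have C_side: "c \<in> C \<and> (x0 \<in> Y \<longleftrightarrow> c \<in> Y)" if "inX\<^sup>*\<^sup>* x0 c" for c
      using that
    proof (induction rule: rtranclp_induct)
      case (step c d)
      then have "adj G c d" "d \<in> X" by (auto simp: inX_def avoiding_def)
      then show ?case using step.IH one[of c d] C_step[of c d] by blast
    qed (use x0C in blast)
    have comp_side: "x \<in> Y \<longleftrightarrow> k \<in> Y" if "off\<^sup>*\<^sup>* x k" for k
      using that
    proof (induction rule: rtranclp_induct)
      case (step c d)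
      then show ?case using one[of c d] by (auto simp: off_def avoiding_def)
    qed simp
    show ?thesis using x C_side comp_side unfolding C_def comp_def by blast
  qed
  show ?thesis
  proof (cases "\<exists>t. ray_of (adj G) t \<and> range t \<subseteq> K")
    \<comment> \<open>Here \<open>K\<close> is rayless. As a component of \<open>G - C\<close> it
      has all its outside neighbours in \<open>C\<close>, so its cut runs between \<open>C\<close>
      and \<open>K\<close>.\<close>
    case False
    define F where "F = edge_cut G K"
    have KV: "K \<subseteq> V" unfolding K_def by (rule comp_V[OF V(2)])
    have KC: "K \<inter> C = {}" using comp_off y0C unfolding K_def by blast
    have F_ends: "\<exists>a\<in>C. \<exists>b\<in>K. gends G f = {a, b} \<and> b \<in> V - X" if "f \<in> F" for f
    proof -
      obtain b a where ab: "b \<in> K" "a \<in> V - K" "gends G f = {b, a}" "f \<in> gedges G"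
        using \<open>f \<in> F\<close> unfolding F_def edge_cut_def V_def by blast
      then have adj: "adj G b a" unfolding adj_def by blast
      have "a \<in> C"
      proof (rule ccontr)
        assume "a \<notin> C"
        then have "a \<in> comp b" using comp_step[OF adj] ab(1) KC by blast
        then show False using ab(1,2) comp_eq[of b y0] unfolding K_def by blast
      qed
      moreover have "b \<notin> X" using C_step[OF \<open>a \<in> C\<close> adj_sym[OF adj]] ab(1) KC by blast
      ultimately show ?thesis using ab KV by (metis DiffI insert_commute subsetD)
    qed
    have eF: "e \<in> F"
      using e0 x0C V KC comp_refl[of y0] unfolding F_def edge_cut_def V_def[symmetric] K_def[symmetric] by blast
    \<comment> \<open>The \<open>X\<close>-ends of the cut lie in \<open>C\<close>, hence in the
      complement of \<open>K\<close>: this is the side that serves as \<open>Z\<close>.\<close>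
    have FZ: "F = edge_cut G (V - K)"
      unfolding F_def edge_cut_def V_def[symmetric] using KV by (auto simp: insert_commute)
    have "nibble G F" unfolding nibble_def rayless_induced_iff[OF G]
      using KV False by (auto simp: F_def V_def)
    \<comment> \<open>\<open>C\<close> and \<open>K\<close> each lie on one side of
      \<open>Y\<close>; a single edge of \<open>F'\<close> between them puts them on opposite sides,
      so all of \<open>F\<close> is in \<open>F'\<close>.\<close>
    moreover have "F' = F" if F': "nibble G F'" "F' \<noteq> {}" "F' \<subseteq> F" for F'
    proof -
      obtain Y where Y: "F' = edge_cut G Y" using F'(1) unfolding nibble_def by blast
      note side = same_side[of Y F, OF F'(3)[unfolded Y]]
      have FC: "\<exists>a\<in>C. \<exists>b\<in>-C. gends G f = {a, b}" if "f \<in> F" for f using F_ends[OF that] KC by blast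
      obtain f where f: "f \<in> F'" using F'(2) by blast
      obtain a b where ab: "a \<in> C" "b \<in> K" "gends G f = {a, b}" using F_ends f F'(3) by blast
      have abY: "a \<in> Y \<longleftrightarrow> b \<notin> Y"
        using f ab(3) unfolding Y edge_cut_def by (auto simp: doubleton_eq_iff)
      have "g \<in> F'" if g: "g \<in> F" for g
      proof -
        obtain c d where cd: "c \<in> C" "d \<in> K" "gends G g = {c, d}" using F_ends[OF g] by blast
        have "a \<in> Y \<longleftrightarrow> c \<in> Y" by (rule side) (use FC ab cd in auto)
        moreover have "b \<in> Y \<longleftrightarrow> d \<in> Y"
          by (rule side) (use FC ab cd KC comp_eq[of b y0] in \<open>auto simp: K_def\<close>)
        moreover have "g \<in> gedges G" using g unfolding F_def edge_cut_def by blast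
        moreover have "c \<in> V" "d \<in> V" using C_V KV cd by blast+
        ultimately show ?thesis
          using abY cd(3) unfolding Y edge_cut_def V_def by (auto simp: insert_commute)
      qed
      then show ?thesis using F'(3) by blast
    qed
    ultimately have "minimal_nonempty_nibble G F" unfolding minimal_nonempty_nibble_def using eF by blast
    moreover have "\<exists>x\<in>X \<inter> (V - K). \<exists>y\<in>V - X - (V - K). gends G f = {x, y}" if "f \<in> F" for f
      using F_ends[OF that] CX KC C_V KV by blast
    ultimately show ?thesis using eF FZ unfolding V_def by blast
  next
    case True
    then obtain t where t: "ray_of (adj G) t" "range t \<subseteq> K" by blast
    \<comment> \<open>Such \<open>z\<close> lie in rayless components of \<open>G - C\<close>;
      \<open>Z\<close> adds these to \<open>C\<close>, while \<open>K\<close> stays outside because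
      of \<open>t\<close>.\<close>
    define thin where "thin z \<longleftrightarrow> (\<nexists>r. ray_of (adj G) r \<and> range r \<subseteq> comp z)" for z
    define Z where "Z = C \<union> {z \<in> V - C. thin z}"
    define F where "F = edge_cut G Z"
    have thin_eq: "thin z \<longleftrightarrow> thin z'" if "z' \<in> comp z" for z z'
      unfolding thin_def comp_eq[OF that] by blast
    have ZV: "Z \<subseteq> V" using C_V unfolding Z_def by blast
    have Kthick: "k \<notin> Z" if "k \<in> K" for k
    proof -
      have "\<not> thin y0" using t unfolding thin_def K_def by blast
      then have "\<not> thin k" using thin_eq that unfolding K_def by blast
      moreover have "k \<notin> C" using that comp_off y0C unfolding K_def by blast
      ultimately show ?thesis unfolding Z_def by blast
    qed
    have F_ends: "\<exists>a\<in>C. \<exists>b\<in>V - X - Z. gends G f = {a, b} \<and> b \<notin> C \<and> \<not> thin b" if "f \<in> F" for f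
    proof -
      obtain a b where ab: "a \<in> Z" "b \<in> V - Z" "gends G f = {a, b}" "f \<in> gedges G"
        using \<open>f \<in> F\<close> unfolding F_def edge_cut_def V_def by blast
      then have adj: "adj G a b" unfolding adj_def by blast
      have b: "b \<notin> C" "\<not> thin b" using ab(2) unfolding Z_def by blast+
      have "a \<in> C"
      proof (rule ccontr)
        assume "a \<notin> C"
        then have "thin a" "b \<in> comp a" using ab(1) comp_step[OF adj] b unfolding Z_def by blast+
        then show False using thin_eq b by blast
      qed
      moreover have "b \<notin> X" using C_step[OF \<open>a \<in> C\<close> adj] b by blast
      ultimately show ?thesis using ab b by blast
    qed
    have Z_rayless: "\<nexists>r. ray_of (adj G) r \<and> range r \<subseteq> Z"
    proof
      assume "\<exists>r. ray_of (adj G) r \<and> range r \<subseteq> Z"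
      then obtain r where r: "ray_of (adj G) r" "range r \<subseteq> Z" by blast
      have off_adj: "off\<^sup>*\<^sup>* y0 (t 0)" using t(2) unfolding K_def comp_def by blast
      have "(adj G)\<^sup>*\<^sup>* y0 (t 0)"
        by (rule mono_rtranclp[rule_format, OF _ off_adj]) (auto simp: off_def avoiding_def)
      then have conn: "(adj G)\<^sup>*\<^sup>* x0 (t 0)" using x0y0 by (rule converse_rtranclp_into_rtranclp[rotated])
      \<comment> \<open>The Bean Graph is excluded with \<open>A = Z\<close>: no ray runs inside
        \<open>X\<close>, and \<open>t\<close> lies outside \<open>Z\<close>, so \<open>r\<close>
        meets \<open>C\<close> only finitely often.\<close>
      have "finite {u \<in> range r. inX\<^sup>*\<^sup>* x0 u}"
      proof (rule finite_reachable_on_ray[OF G nobean r t(1) _ _ _ _ conn])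
        show "range t \<inter> Z = {}" using t(2) Kthick by blast
        show "adj G x y" if "inX x y" for x y using that by (simp add: inX_def avoiding_def)
        show "x \<in> Z" if "inX\<^sup>*\<^sup>* x0 x" for x using that unfolding Z_def C_def by blast
        show "\<nexists>\<rho>. ray_of inX \<rho> \<and> \<rho> 0 = x0"
        proof
          assume "\<exists>\<rho>. ray_of inX \<rho> \<and> \<rho> 0 = x0"
          then obtain \<rho> where "ray_of inX \<rho>" by blast
          then have "ray_of (adj G) \<rho>" "range \<rho> \<subseteq> X" by (auto simp: ray_of_def inX_def avoiding_def)
          then show False using X by blast
        qed
      qed
      then have "finite (r -` {u \<in> range r. inX\<^sup>*\<^sup>* x0 u})"
        using r(1) by (intro finite_vimageI) (auto simp: ray_of_def)
      then obtain N where N: "\<forall>i \<in> r -` {u \<in> range r. inX\<^sup>*\<^sup>* x0 u}. i < N"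
        unfolding finite_nat_set_iff_bounded by metis
      \<comment> \<open>From \<open>N\<close> on, \<open>r\<close> misses \<open>C\<close> and so
        stays in a single component of \<open>G - C\<close>, which is then not thin although
        \<open>r N\<close> lies in \<open>Z\<close>.\<close>
      have rC: "r (i + N) \<notin> C" for i
      proof
        assume "r (i + N) \<in> C"
        then have "i + N \<in> r -` {u \<in> range r. inX\<^sup>*\<^sup>* x0 u}" unfolding C_def by simp
        then show False using N by (meson not_add_less2)
      qed
      have shift: "ray_of (adj G) (\<lambda>i. r (i + N))" using r(1) by (rule ray_of_shift)
      then have "ray_of off (\<lambda>i. r (i + N))"
        by (rule ray_of_mono) (use rC[of "Suc i" for i] rC in \<open>auto simp: off_def avoiding_def\<close>)
      from ray_of_reachable[OF this] have "range (\<lambda>i. r (i + N)) \<subseteq> comp (r N)"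
        unfolding comp_def by auto
      then have "\<not> thin (r N)" using shift unfolding thin_def by blast
      moreover have "r N \<in> Z" "r N \<notin> C" using r(2) rC[of 0] by auto
      ultimately show False unfolding Z_def by blast
    qed
    have eF: "e \<in> F"
      using e0 x0C V Kthick[of y0] comp_refl[of y0] unfolding F_def edge_cut_def V_def[symmetric] K_def Z_def by blast
    have "nibble G F" unfolding nibble_def rayless_induced_iff[OF G]
      using ZV Z_rayless by (auto simp: F_def V_def)
    moreover have "F' = F" if F': "nibble G F'" "F' \<noteq> {}" "F' \<subseteq> F" for F'
    proof -
      obtain Y where Y: "F' = edge_cut G Y" "\<nexists>r. ray_of (adj G) r \<and> range r \<subseteq> Y"
        using F'(1) unfolding nibble_def rayless_induced_iff[OF G] by blast
      note side = same_side[of Y F, OF F'(3)[unfolded Y]]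
      have FC: "\<exists>a\<in>C. \<exists>b\<in>-C. gends G f = {a, b}" if "f \<in> F" for f using F_ends[OF that] by blast
      \<comment> \<open>A component with a ray lies on one side of \<open>Y\<close>, and
        \<open>Y\<close> is rayless; so all ends of \<open>F\<close> outside \<open>C\<close> are
        outside \<open>Y\<close>. One edge of \<open>F'\<close> then forces all of \<open>C\<close>
        into \<open>Y\<close>.\<close>
      have thick: "b \<notin> Y" if b: "b \<notin> C" "\<not> thin b" for b
      proof
        assume "b \<in> Y"
        have "k \<in> Y" if "k \<in> comp b" for k
        proof -
          have "b \<in> Y \<longleftrightarrow> k \<in> Y" by (rule side) (use FC b that in auto)
          then show ?thesis using \<open>b \<in> Y\<close> by blast
        qed
        then show False using b(2) Y(2) unfolding thin_def by blast
      qed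
      obtain f where f: "f \<in> F'" using F'(2) by blast
      obtain a b where ab: "a \<in> C" "b \<notin> Y" "gends G f = {a, b}" using F_ends f F'(3) thick by blast
      have aY: "a \<in> Y" using f ab(2,3) unfolding Y(1) edge_cut_def by (auto simp: doubleton_eq_iff)
      have "g \<in> F'" if g: "g \<in> F" for g
      proof -
        obtain c d where cd: "c \<in> C" "d \<in> V" "d \<notin> Y" "gends G g = {c, d}" using F_ends[OF g] thick by blast
        have "a \<in> Y \<longleftrightarrow> c \<in> Y" by (rule side) (use FC ab cd in auto)
        moreover have "g \<in> gedges G" using g unfolding F_def edge_cut_def by blast
        ultimately show ?thesis using aY cd unfolding Y(1) edge_cut_def V_def by blast
      qed
      then show ?thesis using F'(3) by blast
    qed
    ultimately have "minimal_nonempty_nibble G F" unfolding minimal_nonempty_nibble_def using eF by blast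
    moreover have "\<exists>x\<in>X \<inter> Z. \<exists>y\<in>V - X - Z. gends G f = {x, y}" if "f \<in> F" for f
      using F_ends[OF that] CX unfolding Z_def by blast
    ultimately show ?thesis using eF ZV F_def unfolding V_def by blast
  qed
qed

section \<open>Digraphs\<close>

lemma wf_multigraph_underlying: "wf_digraph D \<Longrightarrow> wf_multigraph (underlying D)"
  unfolding wf_multigraph_def underlying_def by (auto simp: wf_digraph_def)

lemma adj_underlying: "adj (underlying D) x y \<longleftrightarrow> (x, y) \<in> arcs_ends D \<or> (y, x) \<in> arcs_ends D"
  unfolding adj_def underlying_def arcs_ends_def arc_to_ends_def
  by (auto simp: doubleton_eq_iff image_iff)

text \<open>Every edge of the minimal nibble found has its \<open>X\<close>-end in \<open>Z\<close>
  and its other end outside both sets, so it lies in the cut of \<open>X\<close> and keeps its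
  direction with respect to \<open>Z\<close>.\<close>

lemma directed_minimal_nibble:
  assumes D: "wf_digraph D" and nobean: "\<not> contains_subdivision (underlying D) bean_graph"
    and X: "X \<subseteq> verts D" "\<nexists>r. ray_of (adj (underlying D)) r \<and> range r \<subseteq> X"
    and dir: "(\<forall>e\<in>edge_cut (underlying D) X. tail D e \<in> X) \<or> (\<forall>e\<in>edge_cut (underlying D) X. head D e \<in> X)"
    and vw: "vw \<in> edge_cut (underlying D) X"
  shows "\<exists>F. minimal_nonempty_nibble (underlying D) F \<and> directed_cut D F \<and> vw \<in> F"
proof -
  let ?G = "underlying D"
  have sel: "gverts ?G = verts D" "gends ?G f = {tail D f, head D f}" "gedges ?G = arcs D" for f
    by (simp_all add: underlying_def)
  obtain F Z where F: "minimal_nonempty_nibble ?G F" "vw \<in> F" "Z \<subseteq> verts D" "F = edge_cut ?G Z"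
    and ends: "\<And>f. f \<in> F \<Longrightarrow> \<exists>x\<in>X \<inter> Z. \<exists>y\<in>verts D - X - Z. {tail D f, head D f} = {x, y}"
    using minimal_nibble_in_cut[OF wf_multigraph_underlying[OF D] nobean X(2) vw] unfolding sel by blast
  have sub: "F \<subseteq> edge_cut ?G X"
  proof
    fix f assume f: "f \<in> F"
    then have "f \<in> arcs D" unfolding F(4) edge_cut_def sel by blast
    then show "f \<in> edge_cut ?G X" using ends[OF f] unfolding edge_cut_def sel by blast
  qed
  have "(\<forall>f\<in>F. tail D f \<in> Z \<and> head D f \<in> verts D - Z) \<or> (\<forall>f\<in>F. tail D f \<in> verts D - Z \<and> head D f \<in> Z)"
    using dir
  proof
    assume "\<forall>e\<in>edge_cut ?G X. tail D e \<in> X"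
    then have "tail D f \<in> Z \<and> head D f \<in> verts D - Z" if "f \<in> F" for f
      using ends[OF that] sub that by (auto simp: doubleton_eq_iff)
    then show ?thesis by blast
  next
    assume "\<forall>e\<in>edge_cut ?G X. head D e \<in> X"
    then have "tail D f \<in> verts D - Z \<and> head D f \<in> Z" if "f \<in> F" for f
      using ends[OF that] sub that by (auto simp: doubleton_eq_iff)
    then show ?thesis by blast
  qed
  then show ?thesis using F unfolding directed_cut_def by blast
qed

text \<open>All of \<open>r\<close> is reachable from \<open>w\<close>, so without a directed ray
  from \<open>w\<close> the infinite range of \<open>r\<close> would be finite. Keeping
  \<open>d\<close> arbitrary allows a second use with the arcs reversed.\<close>

lemma directed_ray_of_reachable_ray:
  assumes G: "wf_multigraph G" and nobean: "\<not> contains_subdivision G bean_graph"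
    and d: "\<And>x y. d x y \<Longrightarrow> adj G x y"
    and r: "ray_of (adj G) r" "range r \<subseteq> {x. d\<^sup>*\<^sup>* w x}"
    and t: "ray_of (adj G) t" "range t \<inter> {x. d\<^sup>*\<^sup>* w x} = {}"
    and conn: "(adj G)\<^sup>*\<^sup>* w (t 0)"
  shows "\<exists>\<rho>. ray_of d \<rho> \<and> \<rho> 0 = w"
proof (rule ccontr)
  assume "\<not> ?thesis"
  from finite_reachable_on_ray[OF G nobean r t d _ this conn]
  have "finite {u \<in> range r. d\<^sup>*\<^sup>* w u}" by blast
  moreover have "{u \<in> range r. d\<^sup>*\<^sup>* w u} = range r" using r(2) by blast
  ultimately show False using r(1) unfolding ray_of_def by (metis finite_imageD infinite_UNIV_nat)
qed

text \<open>An arc path from the head back to the tail has distinct vertices, so prefixing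
  \<open>e\<close> closes it to a cycle; for a loop the path is empty.\<close>

lemma cycle_through_arc:
  assumes "wf_digraph D" "e \<in> arcs D" "head D e \<rightarrow>\<^sup>*\<^bsub>D\<^esub> tail D e"
  shows "\<exists>c. pre_digraph.cycle D c \<and> e \<in> set c"
proof -
  interpret wf_digraph D by fact
  obtain p where "apath (head D e) p (tail D e)" using assms(3) unfolding reachable_apath by blast
  then have "awalk (tail D e) (e # p) (tail D e)" "distinct (tl (awalk_verts (tail D e) (e # p)))"
    using assms(2) by (auto simp: apath_def awalk_Cons_iff)
  then have "cycle (e # p)" unfolding cycle_def by blast
  then show ?thesis by (intro exI[of _ "e # p"]) simp
qed

lemma double_ray_through_arc:
  assumes e: "wf_digraph D" "e \<in> arcs D"
    and f: "ray_of (\<lambda>x y. (x, y) \<in> arcs_ends D) f" "f 0 = head D e"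
    and b: "ray_of (\<lambda>x y. (y, x) \<in> arcs_ends D) b" "b 0 = tail D e"
    and disj: "range f \<inter> range b = {}"
  shows "\<exists>r a. directed_double_ray D r a \<and> e \<in> range a"
proof -
  \<comment> \<open>\<open>f\<close> occupies the indices from 0 on and \<open>b k\<close> the index
    \<open>- 1 - k\<close>, so \<open>e\<close> joins index -1 to index 0.\<close>
  define r where "r i = (if i \<ge> 0 then f (nat i) else b (nat (- i - 1)))" for i :: int
  \<comment> \<open>The last conjunct forces the choice of \<open>e\<close> itself at -1, where a
    parallel arc could be chosen instead.\<close>
  have step: "\<exists>a. a \<in> arcs D \<and> tail D a = r i \<and> head D a = r (i + 1) \<and> (i = - 1 \<longrightarrow> a = e)" for i
  proof -
    consider "i \<ge> 0" | "i = - 1" | "i < - 1" by linarith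
    then show ?thesis
    proof cases
      case 1
      then have "r i = f (nat i)" "r (i + 1) = f (Suc (nat i))" by (auto simp: r_def nat_add_distrib)
      moreover have "(f (nat i), f (Suc (nat i))) \<in> arcs_ends D" using f unfolding ray_of_def by blast
      ultimately show ?thesis using 1 unfolding arcs_ends_def arc_to_ends_def by auto
    next
      case 2
      then show ?thesis using e f(2) b(2) by (auto simp: r_def)
    next
      case 3
      define k where "k = nat (- i - 2)"
      have "r i = b (Suc k)" "r (i + 1) = b k"
        using 3 unfolding r_def k_def by (auto intro!: arg_cong[of _ _ b])
      moreover have "(b (Suc k), b k) \<in> arcs_ends D" using b unfolding ray_of_def by blast
      ultimately show ?thesis using 3 unfolding arcs_ends_def arc_to_ends_def by auto
    qed
  qed
  then obtain a where a: "\<And>i. a i \<in> arcs D \<and> tail D (a i) = r i \<and> head D (a i) = r (i + 1) \<and> (i = - 1 \<longrightarrow> a i = e)"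
    by metis
  have inj: "inj f" "inj b" "\<And>i j. f i \<noteq> b j" using f b disj unfolding ray_of_def by blast+
  have "inj r"
  proof (rule injI)
    fix i j assume "r i = r j"
    then show "i = j" using inj(3) inj(3)[symmetric]
      by (auto simp: r_def inj_eq[OF inj(1)] inj_eq[OF inj(2)] split: if_splits)
  qed
  moreover have "range r \<subseteq> verts D" using a wf_digraph.tail_in_verts[OF e(1)] by (metis image_subsetI)
  ultimately have "directed_double_ray D r a" using a unfolding directed_double_ray_def by blast
  moreover have "e \<in> range a" using a by (metis rangeI)
  ultimately show ?thesis by blast
qed

section \<open>The three alternatives for an arc\<close>

theorem theorem5p34:
  fixes D :: "('v, 'e) pre_digraph" and vw :: 'e
  assumes "wf_digraph D"
    and "\<not> contains_subdivision (underlying D) bean_graph"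
    and "vw \<in> arcs D"
  shows "(\<exists>c. pre_digraph.cycle D c \<and> vw \<in> set c)
    \<or> (\<exists>r a. directed_double_ray D r a \<and> vw \<in> range a)
    \<or> (\<exists>F. minimal_nonempty_nibble (underlying D) F \<and> directed_cut D F \<and> vw \<in> F)"
proof -
  interpret wf_digraph D by fact
  let ?G = "underlying D"
  define d where "d x y \<longleftrightarrow> (x, y) \<in> arcs_ends D" for x y
  define v where "v = tail D vw"
  define w where "w = head D vw"
  define X where "X = {x. d\<^sup>*\<^sup>* w x}"
  define Y where "Y = {y. (\<lambda>x y. d y x)\<^sup>*\<^sup>* v y}"
  have G: "wf_multigraph ?G" by (rule wf_multigraph_underlying) fact
  have adj: "adj ?G x y \<longleftrightarrow> d x y \<or> d y x" for x y by (simp add: adj_underlying d_def)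
  have d_arc: "d (tail D e) (head D e)" if "e \<in> arcs D" for e
    using that unfolding d_def by (auto simp: arcs_ends_def arc_to_ends_def)
  have vw: "d v w" "v \<in> verts D" "w \<in> verts D" using assms(3) d_arc unfolding v_def w_def by auto
  have d_verts: "x \<in> verts D \<and> y \<in> verts D" if "d x y" for x y
    using that unfolding d_def by (auto simp: arcs_ends_def arc_to_ends_def)
  have XV: "X \<subseteq> verts D"
  proof
    fix x assume "x \<in> X"
    then have "d\<^sup>*\<^sup>* w x" by (simp add: X_def)
    then show "x \<in> verts D" using vw(3) by (rule rtranclp_invariant) (use d_verts in blast)
  qed
  have YV: "Y \<subseteq> verts D"
  proof
    fix x assume "x \<in> Y"
    then have "(\<lambda>x y. d y x)\<^sup>*\<^sup>* v x" by (simp add: Y_def)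
    then show "x \<in> verts D" using vw(2) by (rule rtranclp_invariant) (use d_verts in blast)
  qed
  have Y_conv: "y \<in> Y \<longleftrightarrow> d\<^sup>*\<^sup>* y v" for y
    unfolding Y_def mem_Collect_eq using rtranclp_converseD[of d v y] rtranclp_converseI[of d y v]
    unfolding conversep_iff[abs_def] by blast
  have X_closed: "y \<in> X" if "x \<in> X" "d x y" for x y
    using that unfolding X_def by (auto intro: rtranclp.rtrancl_into_rtrancl)
  have Y_closed: "x \<in> Y" if "y \<in> Y" "d x y" for x y
    using that unfolding Y_conv by (auto intro: converse_rtranclp_into_rtranclp)
  have in_cut: "e \<in> edge_cut ?G Z \<longleftrightarrow> e \<in> arcs D \<and>
      (tail D e \<in> Z \<and> head D e \<in> verts D - Z \<or> head D e \<in> Z \<and> tail D e \<in> verts D - Z)" for e Z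
    unfolding edge_cut_def underlying_def by (auto simp: doubleton_eq_iff)
  show ?thesis
  proof (cases "d\<^sup>*\<^sup>* w v")
    case True
    then have "w \<rightarrow>\<^sup>*\<^bsub>D\<^esub> v"
    proof (induction rule: rtranclp_induct)
      case (step x y)
      then show ?case unfolding d_def by (meson reachable_adj_trans)
    qed (simp add: vw)
    then show ?thesis using cycle_through_arc[OF assms(1,3)] unfolding v_def w_def by blast
  next
    case False
    have disj: "X \<inter> Y = {}" using False by (auto simp: X_def Y_conv dest: rtranclp_trans)
    have wX: "w \<in> X" "v \<in> Y" by (auto simp: X_def Y_def)
    consider "\<nexists>r. ray_of (adj ?G) r \<and> range r \<subseteq> X" | "\<nexists>r. ray_of (adj ?G) r \<and> range r \<subseteq> Y"
      | r t where "ray_of (adj ?G) r" "range r \<subseteq> X" "ray_of (adj ?G) t" "range t \<subseteq> Y"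
      by blast
    then show ?thesis
    proof cases
      case 1
      have "\<forall>e\<in>edge_cut ?G X. head D e \<in> X" using X_closed d_arc in_cut[of _ X] by blast
      moreover have "vw \<in> edge_cut ?G X"
        using assms(3) vw wX disj unfolding in_cut v_def w_def by blast
      ultimately show ?thesis using directed_minimal_nibble[OF assms(1,2) XV 1] by blast
    next
      case 2
      have "\<forall>e\<in>edge_cut ?G Y. tail D e \<in> Y" using Y_closed d_arc in_cut[of _ Y] by blast
      moreover have "vw \<in> edge_cut ?G Y"
        using assms(3) vw wX disj unfolding in_cut v_def w_def by blast
      ultimately show ?thesis using directed_minimal_nibble[OF assms(1,2) YV 2] by blast
    next
      case (3 r t)
      have wv: "adj ?G w v" "adj ?G v w" using vw(1) adj by blast+
      have d_adj: "(adj ?G)\<^sup>*\<^sup>* x y" if "d\<^sup>*\<^sup>* x y" for x y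
        using that by (rule mono_rtranclp[rule_format, rotated]) (simp add: adj)
      have "d\<^sup>*\<^sup>* w (r 0)" "d\<^sup>*\<^sup>* (t 0) v" using 3 unfolding X_def Y_conv[symmetric] by blast+
      \<comment> \<open>The edge \<open>vw\<close> links both sides in the underlying graph: from
        \<open>w\<close> to \<open>v\<close> and against the arcs to \<open>t 0\<close>, likewise
        from \<open>v\<close> to \<open>w\<close> and on to \<open>r 0\<close>.\<close>
      then have "(adj ?G)\<^sup>*\<^sup>* w (t 0)" "(adj ?G)\<^sup>*\<^sup>* v (r 0)"
        using wv d_adj rtranclp_symp[OF symp_adj] by (meson converse_rtranclp_into_rtranclp)+
      moreover have "range t \<inter> X = {}" "range r \<inter> Y = {}" using 3 disj by blast+
      \<comment> \<open>The second instance reverses all arcs and exchanges \<open>r\<close> with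
        \<open>t\<close>, giving a directed ray towards \<open>v\<close>.\<close>
      ultimately obtain f b where f: "ray_of d f" "f 0 = w" and b: "ray_of (\<lambda>x y. d y x) b" "b 0 = v"
        using directed_ray_of_reachable_ray[OF G assms(2), of d r w t]
          directed_ray_of_reachable_ray[OF G assms(2), of "\<lambda>x y. d y x" t v r]
          3 adj unfolding X_def Y_def by blast
      have "range f \<subseteq> X" "range b \<subseteq> Y"
        using ray_of_reachable[OF f(1)] ray_of_reachable[OF b(1)] f(2) b(2) unfolding X_def Y_def by auto
      then have "range f \<inter> range b = {}" using disj by blast
      then show ?thesis
        using double_ray_through_arc[OF assms(1,3), of f b] f b unfolding d_def v_def w_def by blast
    qed
  qed
qed

end
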